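(* For every positive integer $n$, $$C_{n+1}(x,y,z)=\sum_{T\in\operatorname{SYT}(n;3)}\prod_{i=1}^n\sigma_i(T)\; c_1^{w_1(T)}c_2^{w_2(T)}6^{w_3(T)}\,(xyz)^{n+1-\ell(\lambda(T))},$$ where $c_1=xy+yz+xz$ and $c_2=2x+2y+2z$.
   Context: $\mathcal{Q}_m$ is the set of Stirling permutations of $\{1,1,\ldots,m,m\}$ (words using each of $1,\ldots,m$ twice such that all letters between the two occurrences of $i$ are $\geqslant i$). With $\sigma_0=\sigma_{2m+1}=0$, ${\rm asc}(\sigma)$, ${\rm des}(\sigma)$, ${\rm plat}(\sigma)$ count the indices $i\in\{0,\ldots,2m\}$ with $\sigma_i<\sigma_{i+1}$, $\sigma_i>\sigma_{i+1}$, $\sigma_i=\sigma_{i+1}$ respectively, and $C_m(x,y,z)=\sum_{\sigma\in\mathcal{Q}_m}x^{{\rm asc}(\sigma)}y^{{\rm des}(\sigma)}z^{{\rm plat}(\sigma)}$. $\operatorname{SYT}(n;3)$ is the set of standard Young tableaux with $n$ boxes (French convention) having at most $3$ columns. $\ell(\lambda(T))$ is the number of rows of $T$, $w_i(T)$ the number of rows with exactly $i$ boxes. For $1\leqslant i\leqslant n$, $T_i$ is obtained from $T$ by deleting entries $i+1,\ldots,n$, and $\operatorname{col}_k(T_i)$ is the size of its $k$-th column; $\sigma_i(T)=i-\operatorname{col}_1(T_i)+1$ if $i$ lies in the first column of $T$, and $\sigma_i(T)=\operatorname{col}_k(T_i)-\operatorname{col}_{k+1}(T_i)+1$ if $i$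 lies in the $(k+1)$-th column, $k\geqslant1$. *)

theory Defs
  imports Main
begin

(* A word sigma_1 ... sigma_k is the list [sigma_1, ..., sigma_k]. *)

definition stirling_perms :: "nat \<Rightarrow> nat list set" where
  "stirling_perms m = {s.
     set s = {1..m} \<and> (\<forall>i\<in>{1..m}. count_list s i = 2) \<and>
     (\<forall>p q r. p < q \<and> q < r \<and> r < length s \<and> s ! p = s ! r \<longrightarrow> s ! p \<le> s ! q)}"

(* The boundary convention sigma_0 = sigma_{2m+1} = 0. *)
definition padded :: "nat list \<Rightarrow> nat list" where
  "padded s = 0 # s @ [0]"

definition asc :: "nat list \<Rightarrow> nat" where
  "asc s = card {i\<in>{0..length s}. padded s ! i < padded s ! (i + 1)}"

definition des :: "nat list \<Rightarrow> nat" where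
  "des s = card {i\<in>{0..length s}. padded s ! i > padded s ! (i + 1)}"

definition plat :: "nat list \<Rightarrow> nat" where
  "plat s = card {i\<in>{0..length s}. padded s ! i = padded s ! (i + 1)}"

(* The trivariate polynomial C_m, as a function on an arbitrary commutative semiring;
   taking x, y, z to be indeterminates gives the formal polynomial. *)
definition C_poly :: "nat \<Rightarrow> 'a::comm_semiring_1 \<Rightarrow> 'a \<Rightarrow> 'a \<Rightarrow> 'a" where
  "C_poly m x y z = (\<Sum>s\<in>stirling_perms m. x ^ asc s * y ^ des s * z ^ plat s)"

(* A tableau is the list of its rows, each read left to right. In the French convention
   the rows are listed from bottom to top, so the longest row is the head of the list. *)
type_synonym tableau = "nat list list"

definition is_SYT :: "nat \<Rightarrow> tableau \<Rightarrow> bool" where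
  "is_SYT n T \<longleftrightarrow>
     (\<forall>r\<in>set T. r \<noteq> []) \<and>
     sorted_wrt (\<ge>) (map length T) \<and>
     distinct (concat T) \<and> set (concat T) = {1..n} \<and>
     (\<forall>r\<in>set T. sorted_wrt (<) r) \<and>
     (\<forall>i j. i + 1 < length T \<and> j < length (T ! (i + 1)) \<longrightarrow> T ! i ! j < T ! (i + 1) ! j)"

definition SYT :: "nat \<Rightarrow> nat \<Rightarrow> tableau set" where
  "SYT n k = {T. is_SYT n T \<and> (\<forall>r\<in>set T. length r \<le> k)}"

definition num_rows :: "tableau \<Rightarrow> nat" where
  "num_rows T = length T"

definition w :: "nat \<Rightarrow> tableau \<Rightarrow> nat" where
  "w i T = card {p. p < length T \<and> length (T ! p) = i}"

(* T_i: only the boxes with entries at most i are kept. *)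
definition restrict_tab :: "tableau \<Rightarrow> nat \<Rightarrow> tableau" where
  "restrict_tab T i = filter (\<lambda>r. r \<noteq> []) (map (filter (\<lambda>e. e \<le> i)) T)"

(* Columns are numbered from 1: a row meets column k iff it has at least k boxes. *)
definition col :: "nat \<Rightarrow> tableau \<Rightarrow> nat" where
  "col k T = card {p. p < length T \<and> k \<le> length (T ! p)}"

definition col_of :: "tableau \<Rightarrow> nat \<Rightarrow> nat" where
  "col_of T i = (THE k. 1 \<le> k \<and> (\<exists>r\<in>set T. k \<le> length r \<and> r ! (k - 1) = i))"

(* For T a standard Young tableau and i one of its entries, T_i has i boxes and weakly
   decreasing column sizes, so neither subtraction on nat truncates. *)
definition sigma :: "tableau \<Rightarrow> nat \<Rightarrow> nat" where
  "sigma T i =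
     (let Ti = restrict_tab T i; k = col_of T i - 1 in
      if col_of T i = 1 then i - col 1 Ti + 1
      else col k Ti - col (k + 1) Ti + 1)"

end

theory Submission
  imports Defs "HOL-Library.Sublist" "HOL-Computational_Algebra.Formal_Power_Series"
begin

text \<open>Let \<open>u = x y z\<close> and \<open>d = u (\<partial>\<^sub>x + \<partial>\<^sub>y + \<partial>\<^sub>z)\<close>. Inserting two adjacent copies of a new maximum into a
  gap of a word replaces the step in that gap by an ascent, a plateau and a descent, and every
  Stirling permutation arises so exactly once; hence \<open>C\<^sub>m\<^sub>+\<^sub>1 = d C\<^sub>m\<close>. On the other side \<open>d\<close> acts by
  \<open>u \<mapsto> u c\<^sub>1\<close>, \<open>c\<^sub>1 \<mapsto> u c\<^sub>2\<close>, \<open>c\<^sub>2 \<mapsto> 6 u\<close>. Applying it to a factor \<open>u\<close>, \<open>c\<^sub>1\<close> or \<open>c\<^sub>2\<close> of the weight of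
  a tableau corresponds to adding a box in column 1, 2 or 3, and \<open>\<sigma>\<^sub>n\<^sub>+\<^sub>1\<close> counts the available factors.\<close>

section \<open>Stirling permutations\<close>

lemma subseq_Cons_iff_nth:
  "subseq (v # l) s \<longleftrightarrow> (\<exists>p<length s. s ! p = v \<and> subseq l (drop (Suc p) s))"
proof
  assume "subseq (v # l) s"
  then obtain us vs where "s = us @ v # vs" "subseq l vs"
    using list_emb_ConsD by fastforce
  then show "\<exists>p<length s. s ! p = v \<and> subseq l (drop (Suc p) s)"
    by (intro exI[of _ "length us"]) auto
next
  assume "\<exists>p<length s. s ! p = v \<and> subseq l (drop (Suc p) s)"
  then obtain p where p: "p < length s" "s ! p = v" "subseq l (drop (Suc p) s)" by blast
  then have "s = take p s @ v # drop (Suc p) s" by (metis id_take_nth_drop)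
  with p(3) show "subseq (v # l) s"
    by (metis list_emb_append2 subseq_Cons2)
qed

lemma subseq_triple_iff_nth:
  "subseq [u, v, t] s \<longleftrightarrow>
    (\<exists>p q r. p < q \<and> q < r \<and> r < length s \<and> s ! p = u \<and> s ! q = v \<and> s ! r = t)"
  (is "?L \<longleftrightarrow> ?R")
proof
  assume ?L
  then obtain p q r where "p < length s" "s ! p = u" "q < length s - Suc p" "s ! (Suc p + q) = v"
    "r < length s - (Suc q + Suc p)" "s ! (Suc q + Suc p + r) = t"
    by (fastforce simp: subseq_Cons_iff_nth)
  then show ?R
    by (intro exI[of _ p] exI[of _ "Suc p + q"] exI[of _ "Suc q + Suc p + r"]) auto
next
  assume ?R
  then obtain p q r where *: "p < q" "q < r" "r < length s" "s ! p = u" "s ! q = v" "s ! r = t"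
    by blast
  have "subseq [t] (drop (Suc q) s)"
    unfolding subseq_Cons_iff_nth using * by (intro exI[of _ "r - Suc q"]) auto
  then have "subseq [v, t] (drop (Suc p) s)"
    unfolding subseq_Cons_iff_nth[of v] using * by (intro exI[of _ "q - Suc p"]) auto
  then show ?L
    unfolding subseq_Cons_iff_nth[of u] using * by (intro exI[of _ p]) auto
qed

text \<open>The betweenness condition forbids the patterns \<open>[v, e, v]\<close> with
  \<open>e < v\<close>. In this form it is inherited by subsequences and can be checked after
  filtering out a letter.\<close>

lemma mem_stirling_perms_iff:
  "s \<in> stirling_perms m \<longleftrightarrow>
    set s = {1..m} \<and> (\<forall>i\<in>{1..m}. count_list s i = 2) \<and> (\<forall>v e. subseq [v, e, v] s \<longrightarrow> v \<le> e)"
proof -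
  have "(\<forall>p q r. p < q \<and> q < r \<and> r < length s \<and> s ! p = s ! r \<longrightarrow> s ! p \<le> s ! q)
      \<longleftrightarrow> (\<forall>v e. subseq [v, e, v] s \<longrightarrow> v \<le> e)"
    unfolding subseq_triple_iff_nth by (intro iffI allI impI; elim exE conjE; fastforce)
  then show ?thesis unfolding stirling_perms_def by simp
qed

lemma stirling_perms_0: "stirling_perms 0 = {[]}"
  by (auto simp: mem_stirling_perms_iff)

section \<open>Inserting and deleting the maximum\<close>

definition insert_max :: "nat \<Rightarrow> nat list \<Rightarrow> nat \<Rightarrow> nat list" where
  "insert_max m s i = take i s @ [Suc m, Suc m] @ drop i s"

lemma subseq_Cons_append_notin:
  "u \<notin> set a \<Longrightarrow> subseq (u # l) (a @ b) \<longleftrightarrow> subseq (u # l) b"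
  by (induction a) auto

text \<open>The first \<open>M\<close> of the pattern is matched no earlier than the adjacent pair.
  Then \<open>e\<close>, which differs from \<open>M\<close>, must be matched inside
  \<open>b\<close>, where no \<open>M\<close> follows.\<close>

lemma not_subseq_around_max:
  assumes "M \<notin> set a" "M \<notin> set b" "e \<noteq> M"
  shows "\<not> subseq [M, e, M] (a @ [M, M] @ b)"
proof
  assume "subseq [M, e, M] (a @ [M, M] @ b)"
  then have "subseq [M, e, M] (M # M # b)"
    using assms(1) subseq_Cons_append_notin[of M a "[e, M]" "M # M # b"] by simp
  then have "subseq [e, M] b" using assms(3) by simp
  then have "M \<in> set b" by (auto dest: subseq_Cons' simp: subseq_singleton_left)
  with assms(2) show False by blast
qed

text \<open>Deleting letters creates no forbidden pattern. Conversely, in a pattern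
  \<open>[v, e, v]\<close> of the longer word, a maximal \<open>e\<close> is harmless, a maximal
  \<open>v\<close> alone is excluded because its two copies are adjacent, and otherwise the pattern
  survives in \<open>a @ b\<close> after filtering out the maximum.\<close>

lemma stirling_perms_Suc_iff:
  "a @ [Suc m, Suc m] @ b \<in> stirling_perms (Suc m) \<and> Suc m \<notin> set (a @ b)
    \<longleftrightarrow> a @ b \<in> stirling_perms m" (is "?L \<longleftrightarrow> ?R")
proof
  assume L: ?L
  let ?t = "a @ [Suc m, Suc m] @ b"
  have t: "set ?t = {1..Suc m}" "\<And>i. i \<in> {1..Suc m} \<Longrightarrow> count_list ?t i = 2"
      "\<And>v e. subseq [v, e, v] ?t \<Longrightarrow> v \<le> e"
    using conjunct1[OF L] unfolding mem_stirling_perms_iff by blast+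
  have "set (a @ b) = set ?t - {Suc m}" using L by auto
  also have "\<dots> = {1..m}" unfolding t(1) by auto
  finally have "set (a @ b) = {1..m}" .
  moreover have "count_list (a @ b) i = 2" if "i \<in> {1..m}" for i
    using t(2)[of i] that by auto
  moreover have "subseq (a @ b) ?t"
    by (intro list_emb_append_mono subseq_order.order_refl list_emb_append2)
  then have "v \<le> e" if "subseq [v, e, v] (a @ b)" for v e
    using t(3) that subseq_order.order_trans by blast
  ultimately show ?R unfolding mem_stirling_perms_iff by blast
next
  assume R: ?R
  then have set_ab: "set (a @ b) = {1..m}" unfolding mem_stirling_perms_iff by blast
  then have "Suc m \<notin> set (a @ b)" by (simp only: atLeastAtMost_iff) simp
  then have notin: "Suc m \<notin> set a" "Suc m \<notin> set b" by simp_all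
  let ?t = "a @ [Suc m, Suc m] @ b"
  have "set ?t = insert (Suc m) (set (a @ b))" by auto
  also have "\<dots> = {1..Suc m}" unfolding set_ab by auto
  finally have set_t: "set ?t = {1..Suc m}" .
  moreover have "count_list ?t i = 2" if "i \<in> {1..Suc m}" for i
  proof (cases "i = Suc m")
    case True
    with notin show ?thesis by (simp add: count_list_0_iff)
  next
    case False
    with that R show ?thesis unfolding mem_stirling_perms_iff by auto
  qed
  moreover have "v \<le> e" if *: "subseq [v, e, v] ?t" for v e
  proof -
    have v: "v \<in> set ?t" using * by (blast intro: list.set_intros(1) elim: list_emb_set)
    consider "e = Suc m" | "v = Suc m" "e \<noteq> Suc m" | "v \<noteq> Suc m" "e \<noteq> Suc m" by blast
    then show ?thesis
    proof cases
      case 1 with v set_t show ?thesis by auto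
    next
      case 2
      with not_subseq_around_max[OF notin 2(2)] * show ?thesis by metis
    next
      case 3
      have "subseq (filter (\<lambda>i. i \<noteq> Suc m) [v, e, v]) (filter (\<lambda>i. i \<noteq> Suc m) ?t)"
        using * by (rule subseq_filter)
      moreover have "filter (\<lambda>i. i \<noteq> Suc m) a = a" "filter (\<lambda>i. i \<noteq> Suc m) b = b"
        using notin by (auto intro!: filter_True)
      then have "filter (\<lambda>i. i \<noteq> Suc m) ?t = a @ b" by simp
      ultimately have "subseq [v, e, v] (a @ b)" using 3 by simp
      with R show ?thesis unfolding mem_stirling_perms_iff by blast
    qed
  qed
  ultimately show ?L using notin unfolding mem_stirling_perms_iff by simp
qed

text \<open>A letter between the two copies of the maximum would be at least as large, hence a third
  copy. So the copies are adjacent.\<close>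

lemma stirling_perms_Suc_decomp:
  assumes "t \<in> stirling_perms (Suc m)"
  obtains a b where "t = a @ [Suc m, Suc m] @ b" "Suc m \<notin> set (a @ b)"
proof -
  let ?M = "Suc m"
  have t: "set t = {1..?M}" "count_list t ?M = 2" "\<And>v e. subseq [v, e, v] t \<Longrightarrow> v \<le> e"
    using assms unfolding mem_stirling_perms_iff by auto
  obtain a c where ac: "t = a @ ?M # c" "?M \<notin> set a"
    using t(1) split_list_first[of ?M t] by auto
  then have cc: "count_list c ?M = 1" using t(2) by (simp add: count_list_0_iff)
  then have "?M \<in> set c" by (metis count_list_0_iff zero_neq_one)
  then obtain b' b where b: "c = b' @ ?M # b" "?M \<notin> set b'"
    using split_list_first[of ?M c] by auto
  then have "?M \<notin> set b" using cc by (simp add: count_list_0_iff)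
  moreover have "b' = []"
  proof (rule ccontr)
    assume "b' \<noteq> []"
    then obtain e where e: "e \<in> set b'" by (meson list.set_sel(1))
    then obtain b1 b2 where "b' = b1 @ e # b2" by (meson split_list)
    then have "subseq [?M, e, ?M] t"
      unfolding ac b by (simp add: list_emb_append2)
    then have "?M \<le> e" by (rule t(3))
    moreover have "e \<in> set t" using e ac b by simp
    ultimately have "e = ?M" using t(1) by auto
    with e b show False by blast
  qed
  ultimately show ?thesis using that[of a b] ac b by simp
qed

text \<open>Deleting the maximum recovers \<open>s\<close>, and the length of the prefix before it
  recovers the gap \<open>i\<close>, which gives injectivity. Surjectivity comes from the adjacency
  of the two maxima.\<close>

lemma bij_betw_insert_max:
  "bij_betw (\<lambda>(s, i). insert_max m s i)
    (SIGMA s:stirling_perms m. {..length s}) (stirling_perms (Suc m))"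
proof (rule bij_betw_imageI)
  have fil: "filter (\<lambda>j. j \<noteq> Suc m) (insert_max m s i) = s"
    and pos: "i \<le> length s \<Longrightarrow> length (takeWhile (\<lambda>j. j \<noteq> Suc m) (insert_max m s i)) = i"
    if "s \<in> stirling_perms m" for s i
  proof -
    have notin: "Suc m \<notin> set s" using that by (simp add: mem_stirling_perms_iff)
    then have tk: "\<forall>j\<in>set (take i s). j \<noteq> Suc m" and dr: "\<forall>j\<in>set (drop i s). j \<noteq> Suc m"
      by (auto dest: in_set_takeD in_set_dropD)
    then show "filter (\<lambda>j. j \<noteq> Suc m) (insert_max m s i) = s"
      unfolding insert_max_def by (simp add: filter_id_conv)
    show "length (takeWhile (\<lambda>j. j \<noteq> Suc m) (insert_max m s i)) = i" if "i \<le> length s"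
      unfolding insert_max_def using that tk by (simp add: takeWhile_append)
  qed
  show "inj_on (\<lambda>(s, i). insert_max m s i) (SIGMA s:stirling_perms m. {..length s})"
    unfolding inj_on_def by (clarsimp, metis fil pos)
  show "(\<lambda>(s, i). insert_max m s i) ` (SIGMA s:stirling_perms m. {..length s})
      = stirling_perms (Suc m)"
  proof (intro set_eqI iffI)
    fix t assume "t \<in> (\<lambda>(s, i). insert_max m s i) ` (SIGMA s:stirling_perms m. {..length s})"
    then show "t \<in> stirling_perms (Suc m)"
      unfolding insert_max_def using stirling_perms_Suc_iff by fastforce
  next
    fix t assume t: "t \<in> stirling_perms (Suc m)"
    then obtain a b where ab: "t = a @ [Suc m, Suc m] @ b" "Suc m \<notin> set (a @ b)"
      by (rule stirling_perms_Suc_decomp)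
    with t have "a @ b \<in> stirling_perms m" using stirling_perms_Suc_iff by blast
    moreover have "t = insert_max m (a @ b) (length a)" by (simp add: ab insert_max_def)
    ultimately show "t \<in> (\<lambda>(s, i). insert_max m s i) ` (SIGMA s:stirling_perms m. {..length s})"
      by (intro image_eqI[of _ _ "(a @ b, length a)"]) auto
  qed
qed

lemma finite_stirling_perms: "finite (stirling_perms m)"
proof (induction m)
  case 0 show ?case by (simp add: stirling_perms_0)
next
  case (Suc m)
  then have "finite (SIGMA s:stirling_perms m. {..length s})" by simp
  then show ?case using bij_betw_finite[OF bij_betw_insert_max] by blast
qed

lemma sum_stirling_perms_Suc:
  "(\<Sum>t\<in>stirling_perms (Suc m). f t)
    = (\<Sum>s\<in>stirling_perms m. \<Sum>i\<le>length s. f (insert_max m s i))"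
  using sum.reindex_bij_betw[OF bij_betw_insert_max, of f m, symmetric]
  by (simp add: sum.Sigma finite_stirling_perms case_prod_unfold)

section \<open>Weights of words as products over steps\<close>

text \<open>The recursion on the list, rather than an indexed product, lets the product rule and the
  insertion into a gap be treated in one induction.\<close>

fun adj_prod :: "('b \<Rightarrow> 'b \<Rightarrow> 'a) \<Rightarrow> 'b list \<Rightarrow> 'a::comm_monoid_mult" where
  "adj_prod g (a # b # l) = g a b * adj_prod g (b # l)"
| "adj_prod g l = 1"

lemma adj_prod_conv_nth: "adj_prod g (a # l) = (\<Prod>i<length l. g ((a # l) ! i) (l ! i))"
  by (induction l arbitrary: a) (simp_all add: prod.lessThan_Suc_shift del: prod.lessThan_Suc)

definition step_wt :: "'a \<Rightarrow> 'a \<Rightarrow> 'a \<Rightarrow> nat \<Rightarrow> nat \<Rightarrow> 'a" where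
  "step_wt x y z a b = (if a < b then x else if b < a then y else z)"

lemma prod_if_const:
  "finite A \<Longrightarrow> (\<Prod>i\<in>A. if P i then x else 1) = (x::'a::comm_monoid_mult) ^ card {i\<in>A. P i}"
  by (simp add: prod.inter_filter[symmetric])

text \<open>Each step is exactly one of ascent, descent and plateau, so its weight splits into three
  indicator factors.\<close>

lemma stat_wt_eq_adj_prod:
  fixes x y z :: "'a::comm_semiring_1"
  shows "x ^ asc s * y ^ des s * z ^ plat s = adj_prod (step_wt x y z) (padded s)"
proof -
  have "adj_prod (step_wt x y z) (padded s)
      = (\<Prod>i\<in>{0..length s}. step_wt x y z (padded s ! i) (padded s ! (i + 1)))"
    unfolding padded_def adj_prod_conv_nth by (intro prod.cong) auto
  also have "\<dots> = (\<Prod>i\<in>{0..length s}. (if padded s ! i < padded s ! (i + 1) then x else 1)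
       * (if padded s ! i > padded s ! (i + 1) then y else 1)
       * (if padded s ! i = padded s ! (i + 1) then z else 1))"
    by (intro prod.cong) (auto simp: step_wt_def)
  also have "\<dots> = x ^ asc s * y ^ des s * z ^ plat s"
    by (simp add: prod.distrib prod_if_const asc_def des_def plat_def)
  finally show ?thesis by simp
qed

section \<open>Standard Young tableaux\<close>

text \<open>Shape and column conditions between two rows, joined into one transitive relation. The
  conditions on neighbouring rows then become \<open>sorted_wrt dominates\<close>, which splits
  along appended lists.\<close>

definition dominates :: "nat list \<Rightarrow> nat list \<Rightarrow> bool" where
  "dominates r r' \<longleftrightarrow> length r' \<le> length r \<and> (\<forall>j<length r'. r ! j < r' ! j)"

lemma transp_dominates: "transp dominates"
  unfolding transp_def dominates_def by (meson dual_order.strict_trans dual_order.trans order_less_le_trans)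

lemma is_SYT_iff:
  "is_SYT n T \<longleftrightarrow> (\<forall>r\<in>set T. r \<noteq> [] \<and> sorted_wrt (<) r) \<and> sorted_wrt dominates T
    \<and> distinct (concat T) \<and> set (concat T) = {1..n}"
proof -
  have "sorted_wrt dominates T \<longleftrightarrow> (\<forall>i. Suc i < length T \<longrightarrow> dominates (T ! i) (T ! Suc i))"
    by (rule sorted_wrt_iff_nth_Suc_transp[OF transp_dominates])
  moreover have "sorted_wrt (\<ge>) (map length T)
      \<longleftrightarrow> (\<forall>i. Suc i < length T \<longrightarrow> length (T ! Suc i) \<le> length (T ! i))"
    by (subst sorted_wrt_iff_nth_Suc_transp) (auto simp: transp_def)
  ultimately show ?thesis unfolding is_SYT_def dominates_def by auto
qed

text \<open>The only new inequality is \<open>a ! length r < N\<close>, which holds as soon as that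
  box of \<open>a\<close> exists.\<close>

lemma dominates_snoc_right:
  assumes "\<forall>e\<in>set a. e < N"
  shows "dominates a (r @ [N]) \<longleftrightarrow> dominates a r \<and> length r < length a"
  using assms by (auto simp: dominates_def nth_append less_Suc_eq)

text \<open>The new box cannot support a box of \<open>b\<close>, since the entry above it would
  have to exceed \<open>N\<close>.\<close>

lemma dominates_snoc_left:
  assumes "\<forall>e\<in>set b. e < N"
  shows "dominates (r @ [N]) b \<longleftrightarrow> dominates r b"
proof
  assume L: "dominates (r @ [N]) b"
  have "length b \<noteq> Suc (length r)"
  proof
    assume *: "length b = Suc (length r)"
    then have "N < b ! length r" using L by (auto simp: dominates_def)
    moreover have "b ! length r \<in> set b" using * by simp
    ultimately show False using assms by fastforce
  qed
  with L show "dominates r b" by (auto simp: dominates_def nth_append split: if_splits)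
qed (auto simp: dominates_def nth_append)

lemma distinct_set_insert_max_iff:
  "distinct (xs @ Suc n # ys) \<and> set (xs @ Suc n # ys) = {1..Suc n}
    \<longleftrightarrow> distinct (xs @ ys) \<and> set (xs @ ys) = {1..n}"
proof -
  have "set (xs @ Suc n # ys) = insert (Suc n) (set (xs @ ys))"
    "{1..Suc n} = insert (Suc n) {1..n}" "Suc n \<notin> {1..n}" by auto
  moreover have "distinct (xs @ Suc n # ys) \<longleftrightarrow> distinct (xs @ ys) \<and> Suc n \<notin> set (xs @ ys)"
    by auto
  ultimately show ?thesis by (metis insert_ident)
qed

text \<open>The largest entry satisfies every order condition at the end of a row; what remains is
  that the result has a legal shape, that is, that all rows below \<open>r\<close> are
  longer.\<close>

lemma is_SYT_extend_row_iff:
  assumes "r \<noteq> []"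
  shows "is_SYT (Suc n) (A @ (r @ [Suc n]) # B)
    \<longleftrightarrow> is_SYT n (A @ r # B) \<and> (\<forall>a\<in>set A. length r < length a)"
proof -
  let ?T = "A @ r # B" and ?T' = "A @ (r @ [Suc n]) # B"
  have entries: "distinct (concat ?T') \<and> set (concat ?T') = {1..Suc n}
      \<longleftrightarrow> distinct (concat ?T) \<and> set (concat ?T) = {1..n}" (is "?E' \<longleftrightarrow> ?E")
    using distinct_set_insert_max_iff[of "concat A @ r" n "concat B"] by simp
  have rest: "(\<forall>q\<in>set ?T'. q \<noteq> [] \<and> sorted_wrt (<) q) \<and> sorted_wrt dominates ?T' \<longleftrightarrow>
      (\<forall>q\<in>set ?T. q \<noteq> [] \<and> sorted_wrt (<) q) \<and> sorted_wrt dominates ?T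
      \<and> (\<forall>a\<in>set A. length r < length a)" if ?E
  proof -
    have lt: "e < Suc n" if "q \<in> set ?T" "e \<in> set q" for q e
    proof -
      have "e \<in> set (concat ?T)" using that by auto
      with \<open>?E\<close> have "e \<in> {1..n}" by blast
      then show ?thesis by auto
    qed
    have "dominates a (r @ [Suc n]) \<longleftrightarrow> dominates a r \<and> length r < length a" if "a \<in> set A" for a
      using lt[of a] that by (intro dominates_snoc_right) auto
    moreover have "dominates (r @ [Suc n]) b \<longleftrightarrow> dominates r b" if "b \<in> set B" for b
      using lt[of b] that by (intro dominates_snoc_left) auto
    moreover have "sorted_wrt (<) (r @ [Suc n]) \<longleftrightarrow> sorted_wrt (<) r"
      using lt[of r] by (auto simp: sorted_wrt_append)
    ultimately show ?thesis using assms by (auto simp: sorted_wrt_append)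
  qed
  show ?thesis unfolding is_SYT_iff using entries rest by blast
qed

text \<open>A row above would have to begin with an entry exceeding \<open>Suc n\<close>, so the new
  row is the top one, and there the column condition is automatic.\<close>

lemma is_SYT_new_row_iff:
  "is_SYT (Suc n) (A @ [Suc n] # B) \<longleftrightarrow> is_SYT n A \<and> B = []"
proof (cases "B = []")
  case False
  then obtain b B' where b: "B = b # B'" by (cases B) auto
  have False if S: "is_SYT (Suc n) (A @ [Suc n] # B)"
  proof -
    have "b \<noteq> []" "dominates [Suc n] b" using S b by (auto simp: is_SYT_iff sorted_wrt_append)
    then have "Suc n < b ! 0" "b ! 0 \<in> set b" by (auto simp: dominates_def)
    moreover have "set b \<subseteq> {1..Suc n}" using S b unfolding is_SYT_iff by (metis Un_iff concat_append concat.simps(2) set_append subsetI)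
    ultimately show False by auto
  qed
  with False show ?thesis by blast
next
  case True
  have dom: "dominates a [Suc n]" if "set (concat A) = {1..n}" "a \<in> set A" "a \<noteq> []" for a
  proof -
    have "a ! 0 \<in> set a" using that(3) by simp
    then have "a ! 0 \<in> set (concat A)" using that(2) by auto
    then have "a ! 0 < Suc n" unfolding that(1) by simp
    with that(3) show ?thesis by (simp add: dominates_def Suc_le_eq)
  qed
  have entries: "distinct (concat (A @ [[Suc n]])) \<and> set (concat (A @ [[Suc n]])) = {1..Suc n}
      \<longleftrightarrow> distinct (concat A) \<and> set (concat A) = {1..n}"
    using distinct_set_insert_max_iff[of "concat A" n "[]"] by simp
  have sorted: "sorted_wrt dominates (A @ [[Suc n]])
      \<longleftrightarrow> sorted_wrt dominates A \<and> (\<forall>a\<in>set A. dominates a [Suc n])"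
    by (simp add: sorted_wrt_append)
  have rows: "(\<forall>r\<in>set (A @ [[Suc n]]). r \<noteq> [] \<and> sorted_wrt (<) r)
      \<longleftrightarrow> (\<forall>r\<in>set A. r \<noteq> [] \<and> sorted_wrt (<) r)" by simp
  have "is_SYT (Suc n) (A @ [[Suc n]]) \<longleftrightarrow> is_SYT n A"
    unfolding is_SYT_iff rows sorted entries using dom by blast
  with True show ?thesis by simp
qed

section \<open>Column sizes, row counts and restriction\<close>

lemma col_conv_filter: "col k T = length (filter (\<lambda>r. k \<le> length r) T)"
  by (simp add: col_def length_filter_conv_card)

lemma w_conv_filter: "w k T = length (filter (\<lambda>r. length r = k) T)"
  by (simp add: w_def length_filter_conv_card)

text \<open>This turns the difference of adjacent column sizes in \<open>sigma\<close> into a number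
  of rows of given length.\<close>

lemma col_eq_w_plus_col: "col k T = w k T + col (Suc k) T"
  by (induction T) (auto simp: col_conv_filter w_conv_filter)

text \<open>Nonempty rows share \<open>n\<close> entries. The bound keeps
  \<open>n + 1 - length T\<close> from truncating and even makes it positive.\<close>

lemma length_le_if_is_SYT:
  assumes "is_SYT n T"
  shows "length T \<le> n"
proof -
  have "length T \<le> length (concat T)" if "\<forall>r\<in>set T. r \<noteq> []" for T :: tableau
    using that
  proof (induction T)
    case (Cons a T)
    then have "1 \<le> length a" by (simp add: Suc_le_eq)
    with Cons show ?case by simp
  qed simp
  moreover have "length (concat T) = n"
    using assms unfolding is_SYT_iff by (metis card_atLeastAtMost diff_Suc_1 distinct_card)
  ultimately show ?thesis using assms unfolding is_SYT_iff by metis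
qed

lemma col_of_eqI:
  assumes "is_SYT n T" "r \<in> set T" "j < length r" "r ! j = i"
  shows "col_of T i = Suc j"
  unfolding col_of_def
proof (rule the_equality)
  show "1 \<le> Suc j \<and> (\<exists>r\<in>set T. Suc j \<le> length r \<and> r ! (Suc j - 1) = i)"
    using assms(2-4) by (auto intro!: bexI[of _ r])
next
  fix k assume k: "1 \<le> k \<and> (\<exists>r\<in>set T. k \<le> length r \<and> r ! (k - 1) = i)"
  then obtain r' where r': "r' \<in> set T" "k \<le> length r'" "r' ! (k - 1) = i" by blast
  have d: "distinct (concat T)" using assms(1) by (simp add: is_SYT_iff)
  have "i \<in> set r" using assms(3,4) by auto
  moreover have "k - 1 < length r'" using r'(2) conjunct1[OF k] by linarith
  then have "i \<in> set r'" using r'(3) nth_mem by blast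
  ultimately have "set r \<inter> set r' \<noteq> {}" by blast
  then have "r' = r" using d assms(2) r'(1) unfolding distinct_concat_iff by blast
  moreover have "distinct r" using d assms(2) unfolding distinct_concat_iff by blast
  ultimately have "k - 1 = j" using assms r' k by (auto simp: nth_eq_iff_index_eq)
  with conjunct1[OF k] show "k = Suc j" by linarith
qed

lemma col_of_snoc:
  assumes "is_SYT n (A @ (r @ [i]) # B)"
  shows "col_of (A @ (r @ [i]) # B) i = Suc (length r)"
  by (rule col_of_eqI[OF assms, of "r @ [i]"]) auto

lemma is_SYT_entry_le:
  assumes "is_SYT n T" "r \<in> set T" "e \<in> set r"
  shows "1 \<le> e" "e \<le> n"
proof -
  have "e \<in> set (concat T)" using assms(2,3) by auto
  then have "e \<in> {1..n}" using assms(1) unfolding is_SYT_iff by blast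
  then show "1 \<le> e" "e \<le> n" by auto
qed

lemma restrict_tab_eq_self:
  assumes "is_SYT n T" "n \<le> i"
  shows "restrict_tab T i = T"
proof -
  have "filter (\<lambda>e. e \<le> i) r = r" if "r \<in> set T" for r
    using is_SYT_entry_le(2)[OF assms(1) that] assms(2) by (fastforce simp: filter_id_conv)
  then have "map (filter (\<lambda>e. e \<le> i)) T = T" by (simp add: map_idI)
  then show ?thesis
    using assms(1) unfolding restrict_tab_def by (auto simp: is_SYT_iff filter_id_conv)
qed

section \<open>Adding a box\<close>

text \<open>Row lengths weakly decrease, so the rows meeting column \<open>k\<close> form a prefix,
  whose length is \<open>col k T\<close>.\<close>

lemma take_drop_col:
  assumes "sorted_wrt dominates T"
  shows "take (col k T) T = filter (\<lambda>r. k \<le> length r) T"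
    and "drop (col k T) T = filter (\<lambda>r. length r < k) T"
proof -
  have "T = filter (\<lambda>r. k \<le> length r) T @ filter (\<lambda>r. length r < k) T"
    using assms
  proof (induction T)
    case (Cons r T)
    show ?case
    proof (cases "k \<le> length r")
      case True
      with Cons show ?thesis by simp
    next
      case False
      have "\<forall>r'\<in>set T. length r' < k"
        using Cons.prems False by (fastforce simp: dominates_def)
      then have "filter (\<lambda>r. k \<le> length r) T = []" "filter (\<lambda>r. length r < k) T = T"
        by (auto simp: filter_empty_conv filter_id_conv not_le)
      with False show ?thesis by simp
    qed
  qed simp
  then show "take (col k T) T = filter (\<lambda>r. k \<le> length r) T"
    "drop (col k T) T = filter (\<lambda>r. length r < k) T"
    unfolding col_conv_filter by (metis append_eq_conv_conj)+
qed

text \<open>The top of column \<open>k\<close> is in the row with 0-based index \<open>col k T\<close>, which is a new row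
  if this index is \<open>length T\<close>.\<close>

definition add_box :: "tableau \<Rightarrow> nat \<Rightarrow> nat \<Rightarrow> tableau" where
  "add_box T k e = (let p = col k T in
     take p T @ ((if p < length T then T ! p else []) @ [e]) # drop (Suc p) T)"

text \<open>Beyond the first column, a box fits in column \<open>k\<close> exactly if some row has
  \<open>k - 1\<close> boxes. The bound 3 keeps the shape within three columns.\<close>

definition addable :: "tableau \<Rightarrow> nat set" where
  "addable T = {k \<in> {1..3}. k = 1 \<or> 0 < w (k - 1) T}"

lemma col_1: "is_SYT n T \<Longrightarrow> col 1 T = length T"
  by (simp add: col_conv_filter is_SYT_iff Suc_le_eq)

text \<open>A common normal form for both ways of adding a box: \<open>r = []\<close> is a new top
  row, otherwise \<open>r\<close> is extended. The later effects of \<open>add_box\<close> are read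
  off from it.\<close>

lemma add_box_decomp:
  assumes T: "is_SYT n T" and k: "k \<in> addable T"
  obtains A r B where "add_box T k e = A @ (r @ [e]) # B" "Suc (length r) = k"
    "\<forall>a\<in>set A. length r < length a" "r = [] \<and> B = [] \<and> T = A \<or> r \<noteq> [] \<and> T = A @ r # B"
proof (cases "k = 1")
  case True
  show ?thesis
  proof (rule that[of T "[]" "[]"])
    show "add_box T k e = T @ ([] @ [e]) # []"
      using True col_1[OF T] by (simp add: add_box_def)
  qed (use T True in \<open>auto simp: is_SYT_iff\<close>)
next
  case False
  then obtain j where j: "k = Suc j" "0 < j" "0 < w j T"
    using k by (cases k) (auto simp: addable_def)
  let ?p = "col k T"
  have sorted: "sorted_wrt dominates T" using T by (simp add: is_SYT_iff)
  have p: "?p < length T"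
  proof -
    have "col j T \<le> length T" by (simp add: col_conv_filter)
    with j col_eq_w_plus_col[of j T] show ?thesis by simp
  qed
  then have T_eq: "T = take ?p T @ T ! ?p # drop (Suc ?p) T" by (simp add: id_take_nth_drop)
  have drop_eq: "filter (\<lambda>r. length r < k) T = T ! ?p # drop (Suc ?p) T"
    using take_drop_col(2)[OF sorted, of k] p by (simp add: Cons_nth_drop_Suc)
  then have "T ! ?p \<in> set (filter (\<lambda>r. length r < k) T)" by simp
  then have "length (T ! ?p) < k" by simp
  \<comment> \<open>Row \<open>?p\<close> is the first one shorter than \<open>k\<close>, so it is
    at least as long as any row of length \<open>j\<close>; this forces its length to be
    \<open>j\<close>.\<close>
  moreover have "j \<le> length (T ! ?p)"
  proof -
    have "filter (\<lambda>r. length r = j) T \<noteq> []" using j(3) by (auto simp: w_conv_filter)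
    then obtain q where q: "q \<in> set T" "length q = j" by (auto simp: filter_empty_conv)
    then have "q \<in> set (filter (\<lambda>r. length r < k) T)" using j(1) by simp
    then have "q = T ! ?p \<or> q \<in> set (drop (Suc ?p) T)" unfolding drop_eq by auto
    moreover have "dominates (T ! ?p) q" if "q \<in> set (drop (Suc ?p) T)"
      using sorted that by (subst (asm) T_eq) (simp add: sorted_wrt_append)
    ultimately show ?thesis using q(2) by (auto simp: dominates_def)
  qed
  ultimately have len: "length (T ! ?p) = j" using j(1) by simp
  show ?thesis
  proof (rule that[of "take ?p T" "T ! ?p" "drop (Suc ?p) T"])
    show "add_box T k e = take ?p T @ (T ! ?p @ [e]) # drop (Suc ?p) T"
      using p by (simp add: add_box_def Let_def)
    show "\<forall>a\<in>set (take ?p T). length (T ! ?p) < length a"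
      unfolding take_drop_col(1)[OF sorted] len using j(1) by auto
    show "T ! ?p = [] \<and> drop (Suc ?p) T = [] \<and> T = take ?p T
        \<or> T ! ?p \<noteq> [] \<and> T = take ?p T @ T ! ?p # drop (Suc ?p) T"
      using T_eq len j(2) by auto
  qed (use len j(1) in simp)
qed

lemma is_SYT_add_box:
  assumes "is_SYT n T" "k \<in> addable T"
  shows "is_SYT (Suc n) (add_box T k (Suc n))"
proof (rule add_box_decomp[OF assms, of "Suc n"])
  fix A r B
  assume *: "add_box T k (Suc n) = A @ (r @ [Suc n]) # B" "\<forall>a\<in>set A. length r < length a"
    "r = [] \<and> B = [] \<and> T = A \<or> r \<noteq> [] \<and> T = A @ r # B"
  from *(3) show ?thesis
  proof (elim disjE conjE)
    assume "r = []" "B = []" "T = A"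
    then show ?thesis
      using *(1) assms(1) is_SYT_new_row_iff[of n A B] by simp
  next
    assume "r \<noteq> []" "T = A @ r # B"
    then show ?thesis
      using *(1,2) assms(1) is_SYT_extend_row_iff[of r n A B] by simp
  qed
qed

lemma col_of_add_box:
  assumes "is_SYT n T" "k \<in> addable T"
  shows "col_of (add_box T k (Suc n)) (Suc n) = k"
proof (rule add_box_decomp[OF assms, of "Suc n"])
  fix A r B assume "add_box T k (Suc n) = A @ (r @ [Suc n]) # B" "Suc (length r) = k"
  then show ?thesis using is_SYT_add_box[OF assms] col_of_snoc by metis
qed

lemma col_of_add_box_old:
  assumes "is_SYT n T" "k \<in> addable T" "i \<in> {1..n}"
  shows "col_of (add_box T k (Suc n)) i = col_of T i"
proof (rule add_box_decomp[OF assms(1,2), of "Suc n"])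
  fix A r B
  assume *: "add_box T k (Suc n) = A @ (r @ [Suc n]) # B"
    "r = [] \<and> B = [] \<and> T = A \<or> r \<noteq> [] \<and> T = A @ r # B"
  have "i \<in> set (concat T)" using assms(1,3) unfolding is_SYT_iff by blast
  then obtain q j where q: "q \<in> set T" "j < length q" "q ! j = i"
    by (auto simp: in_set_conv_nth[of i])
  then have "\<exists>q'\<in>set (add_box T k (Suc n)). j < length q' \<and> q' ! j = i"
    using * by (auto simp: nth_append intro: bexI[of _ q])
  then show ?thesis
    using col_of_eqI[OF is_SYT_add_box[OF assms(1,2)]] col_of_eqI[OF assms(1) q] by metis
qed

text \<open>Restriction removes the new box, and a row consisting of it alone is dropped as empty.
  Thus \<open>T\<close> can be recovered, and earlier values of \<open>sigma\<close> do not
  change.\<close>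

lemma restrict_tab_add_box:
  assumes "is_SYT n T" "k \<in> addable T" "i < e"
  shows "restrict_tab (add_box T k e) i = restrict_tab T i"
  by (rule add_box_decomp[OF assms(1,2), of e])
    (use assms(3) in \<open>auto simp: restrict_tab_def\<close>)

lemma length_add_box:
  assumes "is_SYT n T" "k \<in> addable T"
  shows "length (add_box T k e) = length T + of_bool (k = 1)"
  by (rule add_box_decomp[OF assms, of e]) auto

text \<open>A row of length \<open>k - 1\<close> becomes one of length \<open>k\<close>. The
  additive form avoids truncated subtraction; \<open>j = 0\<close> is excluded because a new row
  does not arise from an empty row of \<open>T\<close>.\<close>

lemma w_add_box:
  assumes "is_SYT n T" "k \<in> addable T" "1 \<le> j"
  shows "w j (add_box T k e) + of_bool (Suc j = k) = w j T + of_bool (j = k)"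
  by (rule add_box_decomp[OF assms(1,2), of e]) (use assms(3) in \<open>auto simp: w_conv_filter split: if_splits\<close>)

lemma col_add_box:
  assumes "is_SYT n T" "k \<in> addable T" "1 \<le> j"
  shows "col j (add_box T k e) = col j T + of_bool (j = k)"
  by (rule add_box_decomp[OF assms(1,2), of e]) (use assms(3) in \<open>auto simp: col_conv_filter\<close>)

lemma sigma_add_box_old:
  assumes "is_SYT n T" "k \<in> addable T" "i \<in> {1..n}"
  shows "sigma (add_box T k (Suc n)) i = sigma T i"
  using assms restrict_tab_add_box[OF assms(1,2), of i "Suc n"] col_of_add_box_old[OF assms]
  by (simp add: sigma_def)

text \<open>The new box raises \<open>col k\<close> by one, which the \<open>+ 1\<close> in
  \<open>sigma\<close> compensates. The value is therefore the exponent of \<open>u\<close>,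
  \<open>c1\<close> or \<open>c2\<close> in the weight of \<open>T\<close> for \<open>k\<close>
  equal to 1, 2 or 3.\<close>

lemma sigma_add_box_new:
  assumes T: "is_SYT n T" and k: "k \<in> addable T"
  shows "sigma (add_box T k (Suc n)) (Suc n) = (if k = 1 then n + 1 - length T else w (k - 1) T)"
proof -
  have res: "restrict_tab (add_box T k (Suc n)) (Suc n) = add_box T k (Suc n)"
    using is_SYT_add_box[OF T k] by (rule restrict_tab_eq_self) simp
  show ?thesis
  proof (cases "k = 1")
    case True
    have "col 1 (add_box T k (Suc n)) = Suc (length T)"
      using col_add_box[OF T k, of 1] col_1[OF T] True by simp
    with True show ?thesis
      unfolding sigma_def Let_def col_of_add_box[OF T k] res
      using length_le_if_is_SYT[OF T] by simp
  next
    case False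
    then obtain j where j: "k = Suc j" "0 < j" "0 < w j T"
      using k by (cases k) (auto simp: addable_def)
    have "col j (add_box T k (Suc n)) = w j T + col k T"
      "col k (add_box T k (Suc n)) = Suc (col k T)"
      using col_add_box[OF T k, of j] col_add_box[OF T k, of k] j col_eq_w_plus_col[of j T] by auto
    with j show ?thesis
      unfolding sigma_def Let_def col_of_add_box[OF T k] res by simp
  qed
qed

text \<open>Rows increase, so the maximal entry ends its row.\<close>

lemma is_SYT_Suc_decomp:
  assumes T': "is_SYT (Suc n) T'"
  obtains A r B where "T' = A @ (r @ [Suc n]) # B"
proof -
  have "Suc n \<in> set (concat T')" using T' by (auto simp: is_SYT_iff)
  then obtain q where q: "q \<in> set T'" "Suc n \<in> set q" by auto
  then obtain r y where y: "q = r @ Suc n # y" by (meson split_list)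
  have "y = []"
  proof (rule ccontr)
    assume "y \<noteq> []"
    then obtain e where "e \<in> set y" by (meson list.set_sel(1))
    moreover have "sorted_wrt (<) q" using T' q(1) by (simp add: is_SYT_iff)
    ultimately have "Suc n < e" using y by (simp add: sorted_wrt_append)
    moreover have "e \<le> Suc n" using is_SYT_entry_le[OF T' q(1)] \<open>e \<in> set y\<close> y by simp
    ultimately show False by simp
  qed
  moreover obtain A B where "T' = A @ q # B" using q(1) by (meson split_list)
  ultimately show ?thesis using that y by simp
qed

text \<open>Restriction to \<open>n\<close> recovers \<open>T\<close>, and the column of
  \<open>Suc n\<close> recovers \<open>k\<close>. Conversely, removing the box of
  \<open>Suc n\<close> leaves a tableau to which that box can be added.\<close>

lemma bij_betw_add_box:
  "bij_betw (\<lambda>(T, k). add_box T k (Suc n)) (SIGMA T:SYT n 3. addable T) (SYT (Suc n) 3)"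
proof (rule bij_betw_imageI)
  have "restrict_tab (add_box T k (Suc n)) n = T" if "is_SYT n T" "k \<in> addable T" for T k
    using restrict_tab_add_box[OF that] restrict_tab_eq_self[OF that(1)] by simp
  then show "inj_on (\<lambda>(T, k). add_box T k (Suc n)) (SIGMA T:SYT n 3. addable T)"
    unfolding inj_on_def SYT_def by clarsimp (metis col_of_add_box)
  show "(\<lambda>(T, k). add_box T k (Suc n)) ` (SIGMA T:SYT n 3. addable T) = SYT (Suc n) 3"
  proof (intro set_eqI iffI)
    fix T' assume "T' \<in> (\<lambda>(T, k). add_box T k (Suc n)) ` (SIGMA T:SYT n 3. addable T)"
    then obtain T k where T: "T \<in> SYT n 3" "k \<in> addable T" "T' = add_box T k (Suc n)" by auto
    then have S: "is_SYT n T" by (simp add: SYT_def)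
    have "\<forall>r\<in>set T'. length r \<le> 3"
      by (rule add_box_decomp[OF S T(2), of "Suc n"])
        (use T in \<open>auto simp: SYT_def addable_def\<close>)
    then show "T' \<in> SYT (Suc n) 3" using is_SYT_add_box[OF S T(2)] T(3) by (simp add: SYT_def)
  next
    fix T' assume T'_mem: "T' \<in> SYT (Suc n) 3"
    then have T': "is_SYT (Suc n) T'" by (simp add: SYT_def)
    then obtain A r B where T'_eq: "T' = A @ (r @ [Suc n]) # B" by (rule is_SYT_Suc_decomp)
    have le3: "\<forall>q\<in>set A \<union> set B. length q \<le> 3" "length r < 3"
      using T'_mem unfolding SYT_def T'_eq by auto
    have "\<exists>T. T \<in> SYT n 3 \<and> Suc (length r) \<in> addable T \<and> T' = add_box T (Suc (length r)) (Suc n)"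
    proof (cases "r = []")
      case True
      then have A: "is_SYT n A" "B = []"
        using T' is_SYT_new_row_iff[of n A B] unfolding T'_eq by auto
      moreover have "add_box A 1 (Suc n) = A @ [[Suc n]]"
        using col_1[OF A(1)] by (simp add: add_box_def)
      ultimately show ?thesis
        using True le3 T'_eq by (intro exI[of _ A]) (auto simp: SYT_def addable_def)
    next
      case False
      let ?T = "A @ r # B"
      have T: "is_SYT n ?T" and lenA: "\<forall>a\<in>set A. length r < length a"
        using T' is_SYT_extend_row_iff[OF False] unfolding T'_eq by auto
      have "\<forall>b\<in>set B. length b \<le> length r"
        using T by (auto simp: is_SYT_iff sorted_wrt_append dominates_def)
      then have "filter (\<lambda>q. Suc (length r) \<le> length q) B = []"
        by (fastforce simp: filter_empty_conv)
      moreover have "filter (\<lambda>q. Suc (length r) \<le> length q) A = A"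
        using lenA by (simp add: filter_id_conv Suc_le_eq)
      \<comment> \<open>The rows longer than \<open>r\<close> are exactly those of \<open>A\<close>,
        so \<open>add_box\<close> places the box on \<open>r\<close>.\<close>
      ultimately have "filter (\<lambda>q. Suc (length r) \<le> length q) ?T = A" by simp
      then have "add_box ?T (Suc (length r)) (Suc n) = T'"
        unfolding add_box_def col_conv_filter T'_eq by simp
      moreover have "0 < w (length r) ?T" by (simp add: w_conv_filter)
      ultimately show ?thesis
        using T le3 by (intro exI[of _ ?T]) (auto simp: SYT_def addable_def)
    qed
    then show "T' \<in> (\<lambda>(T, k). add_box T k (Suc n)) ` (SIGMA T:SYT n 3. addable T)" by auto
  qed
qed

lemma SYT_0: "SYT 0 k = {[]}"
proof -
  have "T = []" if "is_SYT 0 T" for T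
    using length_le_if_is_SYT[OF that] by simp
  then show ?thesis by (auto simp: SYT_def is_SYT_def)
qed

lemma finite_addable: "finite (addable T)"
  by (simp add: addable_def)

lemma finite_SYT: "finite (SYT n 3)"
proof (induction n)
  case 0 show ?case by (simp add: SYT_0)
next
  case (Suc n)
  then have "finite (SIGMA T:SYT n 3. addable T)" by (simp add: finite_addable)
  then show ?case using bij_betw_finite[OF bij_betw_add_box] by blast
qed

lemma sum_SYT_Suc:
  "(\<Sum>T\<in>SYT (Suc n) 3. f T) = (\<Sum>T\<in>SYT n 3. \<Sum>k\<in>addable T. f (add_box T k (Suc n)))"
  using sum.reindex_bij_betw[OF bij_betw_add_box, of f n, symmetric]
  by (simp add: sum.Sigma finite_SYT finite_addable case_prod_unfold)

section \<open>Both sides as iterated derivatives\<close>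

text \<open>An abstract form of the derivation, so that \<open>x\<close>, \<open>y\<close>,
  \<open>z\<close> need not be indeterminates. \<open>d_1\<close> is an axiom because, without
  additive cancellation, the product rule only yields \<open>d 1 = d 1 + d 1\<close>.\<close>

locale stirling_derivation =
  fixes d :: "'a::comm_semiring_1 \<Rightarrow> 'a" and x y z :: 'a
  assumes d_add: "d (a + b) = d a + d b"
    and d_mult: "d (a * b) = d a * b + a * d b"
    and d_0: "d 0 = 0"
    and d_1: "d 1 = 0"
    and d_x: "d x = x * y * z"
    and d_y: "d y = x * y * z"
    and d_z: "d z = x * y * z"
begin

definition "c1 = x * y + y * z + x * z"
definition "c2 = 2 * x + 2 * y + 2 * z"
definition "u = x * y * z"

lemma d_sum: "finite A \<Longrightarrow> d (\<Sum>i\<in>A. f i) = (\<Sum>i\<in>A. d (f i))"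
  by (induction A rule: finite_induct) (simp_all add: d_0 d_add)

lemma d_of_nat: "d (of_nat k) = 0"
  by (induction k) (simp_all add: d_0 d_1 d_add)

lemma d_numeral: "d (numeral k) = 0"
  using d_of_nat[of "numeral k"] by simp

lemma d_power: "d (f ^ k) = of_nat k * f ^ (k - 1) * d f"
proof (induction k)
  case (Suc k)
  then show ?case by (cases k) (simp_all add: d_1 d_mult algebra_simps)
qed (simp add: d_1)

lemma d_u: "d u = u * c1"
  by (simp add: u_def c1_def d_mult d_x d_y d_z algebra_simps)

lemma d_c1: "d c1 = u * c2"
  by (simp add: u_def c1_def c2_def d_add d_mult d_x d_y d_z algebra_simps mult_2_right)

lemma d_c2: "d c2 = 6 * u"
proof -
  have "d c2 = 2 * u + 2 * u + 2 * u"
    by (simp add: u_def c2_def d_add d_mult d_x d_y d_z d_numeral)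
  also have "\<dots> = (2 + 2 + 2) * u" by (simp only: distrib_right)
  finally show ?thesis by simp
qed

section \<open>The derivation acting on words\<close>

lemma d_step_wt: "d (step_wt x y z a b) = u"
  by (simp add: step_wt_def d_x d_y d_z u_def)

text \<open>The product rule replaces the weight of one step at a time by \<open>u\<close>, and
  \<open>u\<close> is also the weight of the ascent to \<open>M\<close>, the plateau and the descent
  from \<open>M\<close> that an insertion puts there.\<close>

lemma d_adj_prod:
  assumes "\<forall>b\<in>set (a # l). b < M"
  shows "d (adj_prod (step_wt x y z) (a # l))
    = (\<Sum>i<length l. adj_prod (step_wt x y z) (a # take i l @ [M, M] @ drop i l))"
  using assms
proof (induction l arbitrary: a)
  case (Cons b l)
  have "adj_prod (step_wt x y z) (a # M # M # b # l) = u * adj_prod (step_wt x y z) (b # l)"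
    using Cons.prems by (simp add: step_wt_def u_def mult_ac)
  with Cons show ?case
    by (simp add: d_mult d_step_wt sum.lessThan_Suc_shift sum_distrib_left del: sum.lessThan_Suc)
qed (simp add: d_1)

lemma C_poly_Suc: "C_poly (Suc m) x y z = d (C_poly m x y z)"
proof -
  have "d (adj_prod (step_wt x y z) (padded s))
      = (\<Sum>i\<le>length s. adj_prod (step_wt x y z) (padded (insert_max m s i)))"
    if "s \<in> stirling_perms m" for s
  proof -
    have "\<forall>b\<in>set (0 # s @ [0]). b < Suc m"
      using that unfolding mem_stirling_perms_iff by auto
    \<comment> \<open>With \<open>a = 0\<close> and \<open>l = s @ [0]\<close> the summation runs
      over the \<open>length s + 1\<close> gaps of the padded word.\<close>
    from d_adj_prod[OF this] show ?thesis
      by (simp add: padded_def insert_max_def lessThan_Suc_atMost)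
  qed
  then show ?thesis
    unfolding C_poly_def stat_wt_eq_adj_prod
    by (simp add: sum_stirling_perms_Suc d_sum finite_stirling_perms)
qed

section \<open>The derivation acting on tableaux\<close>

definition tab_wt :: "nat \<Rightarrow> tableau \<Rightarrow> 'a" where
  "tab_wt n T = of_nat (\<Prod>i=1..n. sigma T i) * c1 ^ w 1 T * c2 ^ w 2 T * 6 ^ w 3 T
    * u ^ (n + 1 - num_rows T)"

text \<open>No subtraction truncates: \<open>k = 2\<close> is addable only if
  \<open>0 < w 1 T\<close>, and \<open>k = 3\<close> only if \<open>0 < w 2 T\<close>. The exponent
  of \<open>u\<close> grows unless a row is added.\<close>

lemma tab_wt_add_box:
  assumes T: "is_SYT n T" and k: "k \<in> addable T"
  shows "tab_wt (Suc n) (add_box T k (Suc n)) =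
    of_nat (\<Prod>i=1..n. sigma T i) * of_nat (if k = 1 then n + 1 - length T else w (k - 1) T)
    * c1 ^ (w 1 T + of_bool (k = 1) - of_bool (k = 2))
    * c2 ^ (w 2 T + of_bool (k = 2) - of_bool (k = 3))
    * 6 ^ (w 3 T + of_bool (k = 3)) * u ^ (n + 1 - length T + of_bool (k \<noteq> 1))"
proof -
  have "(\<Prod>i=1..Suc n. sigma (add_box T k (Suc n)) i)
      = (\<Prod>i=1..n. sigma T i) * (if k = 1 then n + 1 - length T else w (k - 1) T)"
  proof -
    have "(\<Prod>i=1..n. sigma (add_box T k (Suc n)) i) = (\<Prod>i=1..n. sigma T i)"
      by (intro prod.cong refl sigma_add_box_old[OF T k])
    then show ?thesis by (simp add: sigma_add_box_new[OF T k])
  qed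
  moreover have "k \<le> 3" using k by (simp add: addable_def)
  then have "w 1 (add_box T k (Suc n)) = w 1 T + of_bool (k = 1) - of_bool (k = 2)"
    "w 2 (add_box T k (Suc n)) = w 2 T + of_bool (k = 2) - of_bool (k = 3)"
    "w 3 (add_box T k (Suc n)) = w 3 T + of_bool (k = 3)"
    using w_add_box[OF T k, of 1 "Suc n"] w_add_box[OF T k, of 2 "Suc n"]
      w_add_box[OF T k, of 3 "Suc n"] by (auto split: if_splits)
  moreover have "Suc n + 1 - num_rows (add_box T k (Suc n)) = n + 1 - length T + of_bool (k \<noteq> 1)"
    using length_add_box[OF T k, of "Suc n"] length_le_if_is_SYT[OF T] by (auto simp: num_rows_def)
  ultimately show ?thesis unfolding tab_wt_def by (simp only: of_nat_mult)
qed

lemma sum_addable: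
  "(\<Sum>k\<in>addable T. f k)
    = f 1 + (if 0 < w 1 T then f 2 else 0) + (if 0 < w 2 T then f 3 else 0)"
proof -
  have "addable T = {1} \<union> (if 0 < w 1 T then {2} else {}) \<union> (if 0 < w 2 T then {3} else {})"
    by (auto simp: addable_def numeral_eq_Suc le_Suc_eq)
  then show ?thesis by (simp add: add_ac)
qed

text \<open>Differentiating the powers of \<open>u\<close>, \<open>c1\<close> and \<open>c2\<close>
  yields the terms for a box in column 1, 2 and 3. The exponents brought down are the values of
  \<open>sigma\<close> at the new entry, and the power of 6 is constant.\<close>

lemma d_tab_wt:
  assumes T: "is_SYT n T"
  shows "d (tab_wt n T) = (\<Sum>k\<in>addable T. tab_wt (Suc n) (add_box T k (Suc n)))"
proof -
  define s :: 'a where "s = of_nat (\<Prod>i=1..n. sigma T i)"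
  define e where "e = n - length T"
  have e: "n + 1 - length T = Suc e" using length_le_if_is_SYT[OF T] by (simp add: e_def)
  have "d (tab_wt n T) =
      s * of_nat (Suc e) * c1 ^ Suc (w 1 T) * c2 ^ w 2 T * 6 ^ w 3 T * u ^ Suc e
    + s * of_nat (w 1 T) * c1 ^ (w 1 T - 1) * c2 ^ Suc (w 2 T) * 6 ^ w 3 T * u ^ Suc (Suc e)
    + s * of_nat (w 2 T) * c1 ^ w 1 T * c2 ^ (w 2 T - 1) * 6 ^ Suc (w 3 T) * u ^ Suc (Suc e)"
  proof -
    have "d s = 0" unfolding s_def by (rule d_of_nat)
    moreover have "d (6 ^ w 3 T) = 0" by (simp add: d_power d_numeral)
    ultimately show ?thesis
      unfolding tab_wt_def num_rows_def s_def[symmetric] e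
      by (simp add: d_mult d_power[of c1] d_power[of c2] d_power[of u "Suc e"] d_u d_c1 d_c2
          del: power_Suc of_nat_Suc) (simp add: algebra_simps del: of_nat_Suc)
  qed
  also have "\<dots> = (\<Sum>k\<in>addable T. tab_wt (Suc n) (add_box T k (Suc n)))"
  proof -
    have mem: "1 \<in> addable T" "0 < w 1 T \<Longrightarrow> 2 \<in> addable T" "0 < w 2 T \<Longrightarrow> 3 \<in> addable T"
      by (auto simp: addable_def)
    \<comment> \<open>If \<open>w 1 T\<close> or \<open>w 2 T\<close> is 0, the corresponding term
      has coefficient 0, in agreement with the missing index in \<open>addable T\<close>.\<close>
    show ?thesis
      unfolding sum_addable using mem e
      by (auto simp: tab_wt_add_box[OF T] s_def simp del: of_nat_Suc of_nat_prod power_Suc)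
  qed
  finally show ?thesis .
qed

theorem C_poly_eq_sum_SYT: "C_poly (Suc n) x y z = (\<Sum>T\<in>SYT n 3. tab_wt n T)"
proof (induction n)
  case 0
  \<comment> \<open>The padded empty word \<open>[0, 0]\<close> is a single plateau, so one
    application of \<open>d\<close> gives \<open>u\<close>, the weight of the empty tableau.\<close>
  have "C_poly 0 x y z = z"
    by (simp add: C_poly_def stirling_perms_0 stat_wt_eq_adj_prod padded_def step_wt_def)
  then have "C_poly (Suc 0) x y z = u" using C_poly_Suc[of 0] by (simp add: d_z u_def)
  moreover have "w i [] = 0" for i by (simp add: w_conv_filter)
  ultimately show ?case by (simp add: SYT_0 tab_wt_def num_rows_def)
next
  case (Suc n)
  then have "C_poly (Suc (Suc n)) x y z = (\<Sum>T\<in>SYT n 3. d (tab_wt n T))"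
    by (simp add: C_poly_Suc[of "Suc n"] d_sum finite_SYT)
  also have "\<dots> = (\<Sum>T\<in>SYT (Suc n) 3. tab_wt (Suc n) T)"
    unfolding sum_SYT_Suc by (intro sum.cong refl d_tab_wt) (simp add: SYT_def)
  finally show ?case .
qed

end

section \<open>Specialisation through power series\<close>

lemma fps_power_nth_0_semiring: "fps_nth (f ^ k) 0 = (fps_nth f 0 :: 'a::comm_semiring_1) ^ k"
  by (induction k) simp_all

theorem theorem4p9:
  fixes n :: nat and x y z c1 c2 :: "'a::comm_semiring_1"
  assumes "n \<ge> 1"
    and "c1 = x * y + y * z + x * z"
    and "c2 = 2 * x + 2 * y + 2 * z"
  shows "C_poly (n + 1) x y z =
    (\<Sum>T\<in>SYT n 3. of_nat (\<Prod>i=1..n. sigma T i) *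
       c1 ^ w 1 T * c2 ^ w 2 T * 6 ^ w 3 T * (x * y * z) ^ (n + 1 - num_rows T))"
proof -
  \<comment> \<open>On power series in \<open>t\<close>, the derivative in \<open>t\<close> realises \<open>\<partial>\<^sub>x + \<partial>\<^sub>y + \<partial>\<^sub>z\<close> at \<open>x + t\<close>, \<open>y + t\<close>, \<open>z + t\<close>;
    the claim is then read off at \<open>t = 0\<close>. This needs neither formal polynomials nor cancellation
    in \<open>'a\<close>.\<close>
  define X Y Z where "X = fps_const x + fps_X" and "Y = fps_const y + fps_X"
    and "Z = fps_const z + fps_X"
  \<comment> \<open>\<open>fps_deriv\<close> sends each of \<open>X\<close>, \<open>Y\<close>,
    \<open>Z\<close> to 1, so the factor \<open>X * Y * Z\<close> gives all three the required
    derivative.\<close>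
  interpret stirling_derivation "\<lambda>f. X * Y * Z * fps_deriv f" X Y Z
    by unfold_locales (simp_all add: X_def Y_def Z_def algebra_simps)
  have nth_0: "fps_nth X 0 = x" "fps_nth Y 0 = y" "fps_nth Z 0 = z"
    by (simp_all add: X_def Y_def Z_def)
  \<comment> \<open>Taking the constant coefficient respects sums, products and powers and sends
    \<open>X\<close>, \<open>Y\<close>, \<open>Z\<close> to \<open>x\<close>, \<open>y\<close>,
    \<open>z\<close>.\<close>
  have "fps_nth (C_poly (Suc n) X Y Z) 0 = fps_nth (\<Sum>T\<in>SYT n 3. tab_wt n T) 0"
    by (simp only: C_poly_eq_sum_SYT)
  then show ?thesis
    using assms(2,3)
    by (simp add: C_poly_def tab_wt_def c1_def c2_def u_def fps_sum_nth fps_power_nth_0_semiring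
        nth_0 del: of_nat_prod)
qed

end
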